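(* Let $N\ge1$. For any two braids $a,b\in\mathfrak{B}_N$ and all $i,j\in\{1,\dots,N\}$, $$\mathcal{C}(ab)_{ij}=\mathcal{C}(a)_{ij}+\mathcal{C}(b)_{\pi_a(i),\,\pi_a(j)} .$$
   Context: $\mathfrak{B}_N$ is the $N$-strand braid group with standard Artin generators $\sigma_1,\dots,\sigma_{N-1}$. Braids are drawn going downward; the product $ab$ is $a$ followed (below) by $b$. Strands are numbered $1,\dots,N$ from left to right by their starting positions. A crossing is positive if the strand that is on the left just before the crossing passes over the one on the right (this is $\sigma_i$, at positions $i,i+1$), and negative if the right strand passes over the left one ($\sigma_i^{-1}$). The crossing matrix $\mathcal{C}(b)$ is the $N\times N$ integer matrix with zero diagonal whose $(i,j)$ entry ($i\ne j$) is the number of positive crossings in which strand $i$ passes over strand $j$ minus the number of negative crossings in which strand $i$ passes over strand $j$; it depends only on the braid $b$. For a braid $a$, $\pi_a(i)\in\{1,\dots,N\}$ denotes the ending position of the strand of $a$ starting at position $i$. *)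

theory Defs
  imports "HOL-Algebra.Group" "HOL-Combinatorics.Transposition"
begin

text \<open>
  Letters: \<open>Sig i\<close> stands for \<open>\<sigma>\<^sub>i\<close> and \<open>SigInv i\<close> for its inverse. Strand positions and
  generators are numbered from 1, so on \<open>N\<close> strands the admissible indices are \<open>1 \<le> i < N\<close>.
\<close>

datatype letter = Sig (idx: nat) | SigInv (idx: nat)

type_synonym word = "letter list"

definition words :: "nat \<Rightarrow> word set" where
  "words N = {w. \<forall>l\<in>set w. 1 \<le> idx l \<and> idx l < N}"

inductive_set artin_relations :: "nat \<Rightarrow> (word \<times> word) set" for N :: nat where
  cancel_right: "1 \<le> i \<Longrightarrow> i < N \<Longrightarrow> ([Sig i, SigInv i], []) \<in> artin_relations N"
| cancel_left: "1 \<le> i \<Longrightarrow> i < N \<Longrightarrow> ([SigInv i, Sig i], []) \<in> artin_relations N"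
| far_commute: "1 \<le> i \<Longrightarrow> i + 2 \<le> j \<Longrightarrow> j < N \<Longrightarrow>
    ([Sig i, Sig j], [Sig j, Sig i]) \<in> artin_relations N"
| braid: "1 \<le> i \<Longrightarrow> i + 1 < N \<Longrightarrow>
    ([Sig i, Sig (i + 1), Sig i], [Sig (i + 1), Sig i, Sig (i + 1)]) \<in> artin_relations N"

inductive_set braid_equiv :: "nat \<Rightarrow> (word \<times> word) set" for N :: nat where
  refl: "w \<in> words N \<Longrightarrow> (w, w) \<in> braid_equiv N"
| sym: "(u, v) \<in> braid_equiv N \<Longrightarrow> (v, u) \<in> braid_equiv N"
| trans: "(u, v) \<in> braid_equiv N \<Longrightarrow> (v, w) \<in> braid_equiv N \<Longrightarrow> (u, w) \<in> braid_equiv N"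
| rewrite: "(u, v) \<in> artin_relations N \<Longrightarrow> x \<in> words N \<Longrightarrow> y \<in> words N \<Longrightarrow>
    (x @ u @ y, x @ v @ y) \<in> braid_equiv N"

type_synonym braid = "word set"

definition braid_group :: "nat \<Rightarrow> braid monoid" where
  "braid_group N =
    \<lparr>carrier = words N // braid_equiv N,
     mult = (\<lambda>a b. \<Union>u\<in>a. \<Union>v\<in>b. braid_equiv N `` {u @ v}),
     one = braid_equiv N `` {[]}\<rparr>"

text \<open>
  Words are read from left to right, i.e. down the diagram. \<open>word_end w i\<close> is the final position
  of the strand that starts at position \<open>i\<close>; its position just before the crossing number \<open>k\<close>
  (counted from 0) is \<open>word_end (take k w) i\<close>.
\<close>

definition word_end :: "word \<Rightarrow> nat \<Rightarrow> nat" where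
  "word_end w i = fold (\<lambda>l. transpose (idx l) (idx l + 1)) w i"

definition positive_over :: "word \<Rightarrow> nat \<Rightarrow> nat \<Rightarrow> nat set" where
  "positive_over w i j = {k. k < length w \<and> (\<exists>p. w ! k = Sig p \<and>
     word_end (take k w) i = p \<and> word_end (take k w) j = p + 1)}"

definition negative_over :: "word \<Rightarrow> nat \<Rightarrow> nat \<Rightarrow> nat set" where
  "negative_over w i j = {k. k < length w \<and> (\<exists>p. w ! k = SigInv p \<and>
     word_end (take k w) i = p + 1 \<and> word_end (take k w) j = p)}"

definition word_crossing :: "word \<Rightarrow> nat \<Rightarrow> nat \<Rightarrow> int" where
  "word_crossing w i j =
     (if i = j then 0 else int (card (positive_over w i j)) - int (card (negative_over w i j)))"

text \<open>
  Both functions below take the common value on all words representing the braid (it would be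
  unspecified if that value depended on the word). Matrices are indexed by \<open>{1..N}\<close>; a braid is a
  set of words over the generators of \<open>\<BB>\<^sub>N\<close>, so \<open>N\<close> need not be passed along.
\<close>

definition braid_end :: "braid \<Rightarrow> nat \<Rightarrow> nat"  ("\<pi>") where
  "\<pi> a = the_elem (word_end ` a)"

definition crossing_matrix :: "braid \<Rightarrow> nat \<Rightarrow> nat \<Rightarrow> int"  ("\<C>") where
  "\<C> a = the_elem (word_crossing ` a)"

lemma words_append [simp]: "u @ v \<in> words N \<longleftrightarrow> u \<in> words N \<and> v \<in> words N"
  by (auto simp: words_def)

lemma Nil_in_words [simp]: "[] \<in> words N"
  by (simp add: words_def)

lemma artin_relations_words:
  assumes "(u, v) \<in> artin_relations N" shows "u \<in> words N" "v \<in> words N"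
  using assms by (cases; auto simp: words_def)+

lemma braid_equiv_words:
  assumes "(u, v) \<in> braid_equiv N" shows "u \<in> words N" "v \<in> words N"
proof -
  have "u \<in> words N \<and> v \<in> words N"
    using assms by induction (auto dest: artin_relations_words)
  then show "u \<in> words N" "v \<in> words N" by auto
qed

lemma equiv_braid_equiv: "equiv (words N) (braid_equiv N)"
proof (rule equivI)
  show "braid_equiv N \<subseteq> words N \<times> words N"
    using braid_equiv_words by auto
  show "refl_on (words N) (braid_equiv N)"
    by (auto intro: refl_onI braid_equiv.refl)
  show "sym (braid_equiv N)"
    by (auto intro: symI braid_equiv.sym)
  show "trans (braid_equiv N)"
    by (auto intro: transI braid_equiv.trans)
qed

lemma braid_equiv_context:
  assumes "(u, v) \<in> braid_equiv N" "x \<in> words N" "y \<in> words N"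
  shows "(x @ u @ y, x @ v @ y) \<in> braid_equiv N"
  using assms
proof induction
  case (rewrite u v x' y')
  then show ?case
    using braid_equiv.rewrite[of u v N "x @ x'" "y' @ y"] by simp
qed (auto intro: braid_equiv.intros)

lemma braid_equiv_append:
  assumes "(u, u') \<in> braid_equiv N" "(v, v') \<in> braid_equiv N"
  shows "(u @ v, u' @ v') \<in> braid_equiv N"
proof (rule braid_equiv.trans)
  show "(u @ v, u' @ v) \<in> braid_equiv N"
    using braid_equiv_context[OF assms(1), of "[]" v] braid_equiv_words[OF assms(2)] by simp
  show "(u' @ v, u' @ v') \<in> braid_equiv N"
    using braid_equiv_context[OF assms(2), of u' "[]"] braid_equiv_words[OF assms(1)] by simp
qed

lemma braid_mult_class:
  assumes "u \<in> words N" "v \<in> words N"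
  shows "braid_equiv N `` {u} \<otimes>\<^bsub>braid_group N\<^esub> braid_equiv N `` {v} = braid_equiv N `` {u @ v}"
proof -
  have "congruent2 (braid_equiv N) (braid_equiv N) (\<lambda>u v. braid_equiv N `` {u @ v})"
    by (auto intro!: congruent2I' equiv_class_eq[OF equiv_braid_equiv] braid_equiv_append)
  from UN_equiv_class2[OF equiv_braid_equiv equiv_braid_equiv this assms]
  show ?thesis by (simp add: braid_group_def)
qed

lemma braid_cases:
  assumes "a \<in> carrier (braid_group N)"
  obtains w where "w \<in> words N" "a = braid_equiv N `` {w}"
  using assms by (auto simp: braid_group_def elim: quotientE)

lemma braid_class_carrier:
  "w \<in> words N \<Longrightarrow> braid_equiv N `` {w} \<in> carrier (braid_group N)"
  by (simp add: braid_group_def quotientI)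

lemma braid_left_inverse:
  assumes "w \<in> words N"
  shows "\<exists>v\<in>words N. (v @ w, []) \<in> braid_equiv N"
  using assms
proof (induction w)
  case Nil
  then show ?case by (auto intro!: bexI[of _ "[]"] braid_equiv.refl)
next
  case (Cons l w)
  then obtain v where v: "v \<in> words N" "(v @ w, []) \<in> braid_equiv N"
    by (auto simp: words_def)
  obtain l' where l': "[l'] \<in> words N" "([l', l], []) \<in> artin_relations N"
    using Cons.prems by (cases l) (force simp: words_def intro: artin_relations.intros)+
  have "((v @ [l']) @ l # w, v @ w) \<in> braid_equiv N"
    using braid_equiv.rewrite[OF l'(2) v(1), of w] Cons.prems by (auto simp: words_def)
  then have "((v @ [l']) @ l # w, []) \<in> braid_equiv N"
    using v(2) by (rule braid_equiv.trans)
  moreover have "v @ [l'] \<in> words N"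
    using v l' by simp
  ultimately show ?case by blast
qed

lemma group_braid_group: "group (braid_group N)"
proof (rule groupI)
  have one: "\<one>\<^bsub>braid_group N\<^esub> = braid_equiv N `` {[]}"
    by (simp add: braid_group_def)
  then show "\<one>\<^bsub>braid_group N\<^esub> \<in> carrier (braid_group N)"
    by (simp add: braid_class_carrier)
  fix a assume "a \<in> carrier (braid_group N)"
  then obtain u where u: "u \<in> words N" "a = braid_equiv N `` {u}" by (rule braid_cases)
  show "\<one>\<^bsub>braid_group N\<^esub> \<otimes>\<^bsub>braid_group N\<^esub> a = a"
    using u by (simp add: one braid_mult_class)
  obtain v where "v \<in> words N" "(v @ u, []) \<in> braid_equiv N"
    using braid_left_inverse u by blast
  then have "braid_equiv N `` {v} \<otimes>\<^bsub>braid_group N\<^esub> a = \<one>\<^bsub>braid_group N\<^esub>"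
      "braid_equiv N `` {v} \<in> carrier (braid_group N)"
    using u equiv_class_eq[OF equiv_braid_equiv]
    by (simp_all add: one braid_mult_class braid_class_carrier)
  then show "\<exists>b\<in>carrier (braid_group N). b \<otimes>\<^bsub>braid_group N\<^esub> a = \<one>\<^bsub>braid_group N\<^esub>"
    by blast
next
  fix a b assume "a \<in> carrier (braid_group N)" "b \<in> carrier (braid_group N)"
  then show "a \<otimes>\<^bsub>braid_group N\<^esub> b \<in> carrier (braid_group N)"
    by (auto elim!: braid_cases simp: braid_mult_class braid_class_carrier)
next
  fix a b c assume "a \<in> carrier (braid_group N)" "b \<in> carrier (braid_group N)"
    "c \<in> carrier (braid_group N)"
  then show "a \<otimes>\<^bsub>braid_group N\<^esub> b \<otimes>\<^bsub>braid_group N\<^esub> c =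
      a \<otimes>\<^bsub>braid_group N\<^esub> (b \<otimes>\<^bsub>braid_group N\<^esub> c)"
    by (auto elim!: braid_cases simp: braid_mult_class)
qed

end

theory Submission
  imports Defs
begin

text \<open>
  On words the identity holds for a pictorial reason: in the diagram of \<open>u v\<close> the crossings of
  strand \<open>i\<close> over strand \<open>j\<close> are those inside \<open>u\<close>, together with those inside \<open>v\<close>, where the two
  strands enter at the positions to which \<open>u\<close> has carried them. Thus \<^const>\<open>word_crossing\<close> is a
  cocycle for the action of words on positions (\<open>word_crossing_append\<close>).

  To descend to braids one needs \<^const>\<open>word_end\<close> and \<^const>\<open>word_crossing\<close> to be constant on
  classes. The cocycle identity makes this local: exchanging a subword for another with the
  same end positions and the same crossing numbers changes neither quantity for the whole word. It
  therefore suffices to compare the two sides of each Artin relation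
  (\<open>word_end_artin\<close>, \<open>word_crossing_artin\<close>), where the identity, now applied letter by
  letter, leaves a finite computation with transpositions.
\<close>

lemma word_end_append: "word_end (u @ v) i = word_end v (word_end u i)"
  by (simp add: word_end_def)

lemma word_end_Nil [simp]: "word_end [] i = i"
  by (simp add: word_end_def)

lemma word_end_Cons: "word_end (l # w) i = word_end w (transpose (idx l) (idx l + 1) i)"
  by (simp add: word_end_def)

lemma word_end_eq_iff: "word_end w i = word_end w j \<longleftrightarrow> i = j"
  by (induction w arbitrary: i j) (simp_all add: word_end_Cons inj_eq[OF inj_transpose])

lemma finite_over: "finite (positive_over w i j)" "finite (negative_over w i j)"
  by (simp_all add: positive_over_def negative_over_def)

lemma positive_over_append:
  "positive_over (u @ v) i j =
     positive_over u i j \<union> (+) (length u) ` positive_over v (word_end u i) (word_end u j)"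
  (is "?L = ?A \<union> ?B")
proof (rule Set.set_eqI)
  fix k
  show "k \<in> ?L \<longleftrightarrow> k \<in> ?A \<union> ?B"
  proof (cases "k < length u")
    case True
    then show ?thesis by (auto simp: positive_over_def nth_append)
  next
    case False
    then obtain m where "k = length u + m" by (metis le_Suc_ex not_less)
    then show ?thesis by (auto simp: positive_over_def nth_append word_end_append)
  qed
qed

lemma negative_over_append:
  "negative_over (u @ v) i j =
     negative_over u i j \<union> (+) (length u) ` negative_over v (word_end u i) (word_end u j)"
  (is "?L = ?A \<union> ?B")
proof (rule Set.set_eqI)
  fix k
  show "k \<in> ?L \<longleftrightarrow> k \<in> ?A \<union> ?B"
  proof (cases "k < length u")
    case True
    then show ?thesis by (auto simp: negative_over_def nth_append)
  next
    case False
    then obtain m where "k = length u + m" by (metis le_Suc_ex not_less)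
    then show ?thesis by (auto simp: negative_over_def nth_append word_end_append)
  qed
qed

lemma card_over_append:
  "card (positive_over (u @ v) i j) =
     card (positive_over u i j) + card (positive_over v (word_end u i) (word_end u j))"
  "card (negative_over (u @ v) i j) =
     card (negative_over u i j) + card (negative_over v (word_end u i) (word_end u j))"
proof -
  let ?P = "positive_over v (word_end u i) (word_end u j)"
    and ?M = "negative_over v (word_end u i) (word_end u j)"
  have "positive_over u i j \<inter> (+) (length u) ` ?P = {}"
    and "negative_over u i j \<inter> (+) (length u) ` ?M = {}"
    by (auto simp: positive_over_def negative_over_def)
  then show "card (positive_over (u @ v) i j) = card (positive_over u i j) + card ?P"
    and "card (negative_over (u @ v) i j) = card (negative_over u i j) + card ?M"
    by (simp_all add: positive_over_append negative_over_append card_Un_disjoint finite_over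
        card_image)
qed

text \<open>
  The convention that the diagonal vanishes is compatible with concatenation because distinct
  strands occupy distinct positions (\<open>word_end_eq_iff\<close>).
\<close>

lemma word_crossing_append:
  "word_crossing (u @ v) i j =
     word_crossing u i j + word_crossing v (word_end u i) (word_end u j)"
  by (simp add: word_crossing_def card_over_append word_end_eq_iff)

lemma word_crossing_Nil: "word_crossing [] i j = 0"
  by (simp add: word_crossing_def positive_over_def negative_over_def)

lemma word_crossing_Sig: "word_crossing [Sig p] i j = (if i = p \<and> j = p + 1 then 1 else 0)"
proof -
  have "positive_over [Sig p] i j = (if i = p \<and> j = p + 1 then {0} else {})"
    "negative_over [Sig p] i j = {}"
    by (auto simp: positive_over_def negative_over_def)
  then show ?thesis by (auto simp: word_crossing_def)
qed

lemma word_crossing_SigInv: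
  "word_crossing [SigInv p] i j = (if i = p + 1 \<and> j = p then -1 else 0)"
proof -
  have "negative_over [SigInv p] i j = (if i = p + 1 \<and> j = p then {0} else {})"
    "positive_over [SigInv p] i j = {}"
    by (auto simp: positive_over_def negative_over_def)
  then show ?thesis by (auto simp: word_crossing_def)
qed

lemma word_crossing_Cons:
  "word_crossing (l # w) i j = word_crossing [l] i j +
     word_crossing w (transpose (idx l) (idx l + 1) i) (transpose (idx l) (idx l + 1) j)"
  using word_crossing_append[of "[l]" w i j] by (simp add: word_end_Cons)

lemma word_end_artin:
  assumes "(u, v) \<in> artin_relations N"
  shows "word_end u i = word_end v i"
  using assms by cases (auto simp: word_end_Cons transpose_def)

text \<open>
  For the cancelling pairs, the strand passing over in the first crossing is again the upper one in
  the second, which has the opposite sign. In the braid relation both sides are positive lifts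
  of the order-reversing permutation of three strands: each pair of strands crosses exactly once,
  the strand that starts further left passing over.
\<close>

lemma word_crossing_artin:
  assumes "(u, v) \<in> artin_relations N"
  shows "word_crossing u i j = word_crossing v i j"
  using assms
proof cases
  case (cancel_right p)
  then show ?thesis
    by (auto simp: word_crossing_Cons[of _ "_ # _"] word_crossing_Nil word_crossing_Sig
        word_crossing_SigInv transpose_def)
next
  case (cancel_left p)
  then show ?thesis
    by (auto simp: word_crossing_Cons[of _ "_ # _"] word_crossing_Nil word_crossing_Sig
        word_crossing_SigInv transpose_def)
next
  case (far_commute p q)
  then show ?thesis
    by (auto simp: word_crossing_Cons[of _ "_ # _"] word_crossing_Sig transpose_def)
next
  case (braid p)
  then show ?thesis
    by (auto simp: word_crossing_Cons[of _ "_ # _"] word_crossing_Sig transpose_def)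
qed

lemma word_end_braid_equiv:
  assumes "(u, v) \<in> braid_equiv N"
  shows "word_end u = word_end v"
  using assms by induction (auto simp: word_end_append word_end_artin)

text \<open>
  Inside a longer word, the part below the exchanged subword keeps its contribution because its
  strands still enter at the same positions; hence the appeal to \<open>word_end_artin\<close>.
\<close>

lemma word_crossing_braid_equiv:
  assumes "(u, v) \<in> braid_equiv N"
  shows "word_crossing u = word_crossing v"
  using assms
  by induction (auto simp: word_crossing_append word_end_artin word_crossing_artin)

lemma the_elem_image_braid_class:
  assumes "w \<in> words N" and "\<And>v. (w, v) \<in> braid_equiv N \<Longrightarrow> f w = f v"
  shows "the_elem (f ` (braid_equiv N `` {w})) = f w"
proof (rule the_elem_image_unique)
  show "braid_equiv N `` {w} \<noteq> {}"
    using braid_equiv.refl[OF assms(1)] by blast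
qed (use assms(2) in auto)

lemma braid_end_class: "w \<in> words N \<Longrightarrow> \<pi> (braid_equiv N `` {w}) = word_end w"
  by (simp add: braid_end_def the_elem_image_braid_class word_end_braid_equiv)

lemma crossing_matrix_class: "w \<in> words N \<Longrightarrow> \<C> (braid_equiv N `` {w}) = word_crossing w"
  by (simp add: crossing_matrix_def the_elem_image_braid_class word_crossing_braid_equiv)

theorem proposition1:
  fixes N :: nat and a b :: braid and i j :: nat
  assumes "N \<ge> 1"
    and "a \<in> carrier (braid_group N)" and "b \<in> carrier (braid_group N)"
    and "i \<in> {1..N}" and "j \<in> {1..N}"
  shows "\<C> (a \<otimes>\<^bsub>braid_group N\<^esub> b) i j = \<C> a i j + \<C> b (\<pi> a i) (\<pi> a j)"
proof -
  obtain u where u: "u \<in> words N" "a = braid_equiv N `` {u}"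
    using assms(2) by (rule braid_cases)
  obtain v where v: "v \<in> words N" "b = braid_equiv N `` {v}"
    using assms(3) by (rule braid_cases)
  show ?thesis
    using u v
    by (simp add: braid_mult_class crossing_matrix_class braid_end_class word_crossing_append)
qed

end
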